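(* Let $\theta\in(0,1)$ and let $\mathbb{T}\colon\mathcal{H}\to\mathcal{H}$ be $\theta$-averaged with respect to the norm $\|\cdot\|$. Let $\mathcal{I}^0,\mathcal{I}^1,\ldots$ be IID random vectors in $[0,1]^m$ whose common distribution satisfies $\mathbb{E}[\mathcal{I}]=\alpha\mathbf{1}$ with some $\alpha\in(0,1]$. Let $x^0\in\mathcal{H}$ and $x^{k+1}=\mathbb{T}_{\mathcal{I}^k}x^k$ for $k=0,1,2,\dots$. Let $\mathbf{v}$ be the infimal displacement vector of $\mathbb{T}$. Then, with probability $1$, $\frac{x^k}{k}$ converges strongly to $-\alpha\mathbf{v}$ as $k\to\infty$.
   Context: $\mathcal{H}=\mathcal{H}_1\oplus\cdots\oplus\mathcal{H}_m$ is a direct sum of real Hilbert spaces, with $\langle x,y\rangle=\sum_{i=1}^m\langle x_i,y_i\rangle_i$ and $\|x\|^2=\sum_{i=1}^m\|x_i\|_i^2$, where $x_i\in\mathcal{H}_i$ is the $i$th block of $x$. $\mathrm{Id}$ is the identity operator. An operator $\mathbb{T}$ is $\theta$-averaged with respect to a norm, $\theta\in(0,1)$, if $\mathbb{T}=(1-\theta)\mathrm{Id}+\theta\mathbb{C}$ for some operator $\mathbb{C}$ that is non-expansive (1-Lipschitz) in that norm. Put $\mathbb{S}=\theta^{-1}(\mathrm{Id}-\mathbb{T})$ and $\mathbb{S}_ix=(0,\dots,0,(\mathbb{S}x)_i,0,\dots,0)$ (only the $i$th block kept). For a selection vector $\mathcal{I}=(\mathcal{I}_1,\dots,\mathcal{I}_m)\in[0,1]^m$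 put $\mathbb{S}_{\mathcal{I}}=\sum_{i=1}^m\mathcal{I}_i\mathbb{S}_i$ and $\mathbb{T}_{\mathcal{I}}=\mathrm{Id}-\theta\mathbb{S}_{\mathcal{I}}$. $\mathbf{1}\in\mathbb{R}^m$ is the all-ones vector. The infimal displacement vector $\mathbf{v}$ of $\mathbb{T}$ is the unique minimum-norm element of the nonempty closed convex set $\overline{\mathrm{range}(\mathrm{Id}-\mathbb{T})}$. The starting point $x^0$ is deterministic. *)

theory Defs
  imports "HOL-Probability.Probability"
begin

text \<open>
  The blocks \<open>V i\<close> are arbitrary Hilbert spaces, possibly different for different \<open>i\<close>. As the
  components of a vector share one type, they are represented as complete linear subspaces of a
  common real inner product space. This loses no generality: finitely many Hilbert spaces embed
  isometrically into their direct sum. The number of blocks is \<open>CARD('m)\<close>, and the inner product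
  and norm of \<open>'a ^ 'm\<close> are those of the direct sum.
\<close>

definition hilbert_subspace :: "'a::real_inner set \<Rightarrow> bool" where
  "hilbert_subspace W \<longleftrightarrow> subspace W \<and> Topological_Spaces.complete W"

definition direct_sum :: "('m::finite \<Rightarrow> 'a::real_inner set) \<Rightarrow> ('a ^ 'm) set" where
  "direct_sum V = {x. \<forall>i. x $ i \<in> V i}"

text \<open>Operators on a carrier \<open>H\<close> are HOL functions whose values outside \<open>H\<close> are irrelevant.\<close>

definition averaged_on :: "real \<Rightarrow> 'b::real_normed_vector set \<Rightarrow> ('b \<Rightarrow> 'b) \<Rightarrow> bool" where
  "averaged_on \<theta> H T \<longleftrightarrow>
     (\<exists>C. C \<in> H \<rightarrow> H \<and> 1-lipschitz_on H C \<and>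
        (\<forall>x\<in>H. T x = (1 - \<theta>) *\<^sub>R x + \<theta> *\<^sub>R C x))"

definition S_op :: "real \<Rightarrow> ('b::real_vector \<Rightarrow> 'b) \<Rightarrow> 'b \<Rightarrow> 'b" where
  "S_op \<theta> T x = inverse \<theta> *\<^sub>R (x - T x)"

definition S_block ::
    "real \<Rightarrow> ('a::real_inner ^ 'm::finite \<Rightarrow> 'a ^ 'm) \<Rightarrow> 'm \<Rightarrow> 'a ^ 'm \<Rightarrow> 'a ^ 'm" where
  "S_block \<theta> T i x = axis i (S_op \<theta> T x $ i)"

definition S_sel ::
    "real \<Rightarrow> ('a::real_inner ^ 'm::finite \<Rightarrow> 'a ^ 'm) \<Rightarrow> real ^ 'm \<Rightarrow> 'a ^ 'm \<Rightarrow> 'a ^ 'm" where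
  "S_sel \<theta> T s x = (\<Sum>i\<in>UNIV. (s $ i) *\<^sub>R S_block \<theta> T i x)"

definition T_sel ::
    "real \<Rightarrow> ('a::real_inner ^ 'm::finite \<Rightarrow> 'a ^ 'm) \<Rightarrow> real ^ 'm \<Rightarrow> 'a ^ 'm \<Rightarrow> 'a ^ 'm" where
  "T_sel \<theta> T s x = x - \<theta> *\<^sub>R S_sel \<theta> T s x"

text \<open>
  If \<open>H\<close> is complete, it is closed in the ambient type, so the closure below is also the closure
  within \<open>H\<close>.
\<close>

definition infimal_displacement :: "'b::real_normed_vector set \<Rightarrow> ('b \<Rightarrow> 'b) \<Rightarrow> 'b" where
  "infimal_displacement H T =
     (THE v. v \<in> closure ((\<lambda>x. x - T x) ` H) \<and>
             (\<forall>w \<in> closure ((\<lambda>x. x - T x) ` H). norm v \<le> norm w))"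

end

theory Submission
  imports Defs
begin

text \<open>
  Write \<open>v\<close> for the infimal displacement vector of \<open>T\<close> and put \<open>U = (1 - \<alpha>) Id + \<alpha> T\<close>, which is
  the average of \<open>T_sel \<theta> T s\<close> over the random selection \<open>s\<close>. The random iteration \<open>x\<^sub>k\<close> is compared
  with the deterministic orbit \<open>z\<^sub>k = U\<^sup>k x\<^sub>0\<close>, and the theorem splits into \<open>z\<^sub>k / k \<longlonglongrightarrow> - \<alpha> v\<close> and
  \<open>(x\<^sub>k - z\<^sub>k) / k \<longlonglongrightarrow> 0\<close> almost surely.

  The deterministic limit is Pazy's theorem (\<open>nonexpansive_average_displacement\<close>). It rests on
  \<open>ex_variational_displacement\<close>: some \<open>v\<close> in the closure of \<open>range (Id - T)\<close> satisfies
  \<open>\<parallel>v\<parallel>\<^sup>2 \<le> \<langle>u - T u, v\<rangle>\<close> for all \<open>u\<close>. This inequality identifies \<open>v\<close> as the unique vector of least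
  norm. Taking \<open>v\<close> as the limit of displacements along the resolvents of \<open>Id - T\<close> yields existence, the
  inequality and uniqueness together, and avoids proving that the closed range is convex. As
  displacements of \<open>U\<close> are \<open>\<alpha>\<close> times those of \<open>T\<close>, the vector for \<open>U\<close> is \<open>\<alpha> v\<close>.

  For the random part put \<open>W\<^sub>k = \<parallel>x\<^sub>k - z\<^sub>k\<parallel>\<^sup>2\<close>. A block-selected step need not be non-expansive, but
  its mean square behaves well: because the selection at time \<open>k\<close> is independent of the past and
  has mean \<open>\<alpha>\<close> in each block, and because the displacement of an averaged operator is cocoercive,
  \<open>E[W\<^sub>k\<^sub>+\<^sub>1 | past] \<le> W\<^sub>k + \<parallel>z\<^sub>k - T z\<^sub>k\<parallel>\<^sup>2 / (1 - \<theta>)\<close> (\<open>mean_square_step\<close>). The noise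
  term involves only the displacement along the deterministic orbit, which never exceeds the initial
  one, so it is at most a constant \<open>K\<close>. This is the reason to compare with \<open>z\<^sub>k\<close> and not with the
  straight line \<open>x\<^sub>0 - \<alpha> k v\<close>: the infimal displacement need not be attained, and an approximation
  error would then enter every step.
  Hence \<open>(W\<^sub>k + K (k + 1)) / (k + 1)\<^sup>2\<close> is a non-negative supermartingale with mean at most
  \<open>2 K / (k + 1)\<close>, and a maximal inequality makes it converge to \<open>0\<close> almost surely
  (\<open>supermartingale_AE_tendsto_0\<close>).

  The ambient space need not be separable, so measurability cannot be obtained by adding and
  composing measurable vector-valued maps. Instead each iterate is a continuous function of the
  sequence of selections, which lives in the second countable space \<open>nat \<Rightarrow> real ^ 'm\<close>. All
  quantities whose means are estimated are real functions of that sequence, and the continuous ones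
  among them are bounded along the selections, which range over a compact set.
\<close>

section \<open>Direct sums as Hilbert spaces\<close>

lemma subspace_direct_sum:
  assumes "\<And>i. subspace (V i)"
  shows "subspace (direct_sum V)"
  using assms by (auto simp: direct_sum_def subspace_def)

lemma complete_direct_sum:
  fixes V :: "'m::finite \<Rightarrow> 'a::real_inner set"
  assumes "\<And>i. Topological_Spaces.complete (V i)"
  shows "Topological_Spaces.complete (direct_sum V)"
  unfolding complete_def
proof (intro allI impI, elim conjE)
  fix f :: "nat \<Rightarrow> 'a ^ 'm"
  assume f: "\<forall>n. f n \<in> direct_sum V" and "Cauchy f"
  have "\<exists>l\<in>V i. (\<lambda>n. f n $ i) \<longlonglongrightarrow> l" for i
  proof -
    have "\<forall>n. f n $ i \<in> V i" using f by (simp add: direct_sum_def)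
    moreover have "Cauchy (\<lambda>n. f n $ i)"
      using \<open>Cauchy f\<close> unfolding Cauchy_def by (meson dist_vec_nth_le le_less_trans)
    ultimately show ?thesis using assms[of i] unfolding complete_def by (elim allE[of _ "\<lambda>n. f n $ i"]) blast
  qed
  then obtain l where l: "\<And>i. l i \<in> V i" "\<And>i. (\<lambda>n. f n $ i) \<longlonglongrightarrow> l i" by metis
  have "f \<longlonglongrightarrow> (\<chi> i. l i)"
    by (rule vec_tendstoI) (simp add: l)
  moreover have "(\<chi> i. l i) \<in> direct_sum V"
    by (simp add: direct_sum_def l)
  ultimately show "\<exists>l\<in>direct_sum V. f \<longlonglongrightarrow> l" by blast
qed

section \<open>Infimal displacement vectors of non-expansive operators\<close>

lemma nonexpansive_displacement_monotone:
  fixes T :: "'b::real_inner \<Rightarrow> 'b"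
  assumes T: "1-lipschitz_on H T" and "x \<in> H" "y \<in> H"
  shows "0 \<le> ((x - T x) - (y - T y)) \<bullet> (x - y)"
proof -
  have "norm (T x - T y) \<le> norm (x - y)"
    using lipschitz_onD[OF T assms(2,3)] by (simp add: dist_norm)
  then have "(T x - T y) \<bullet> (x - y) \<le> norm (x - y) * norm (x - y)"
    using norm_cauchy_schwarz[of "T x - T y" "x - y"]
    by (meson mult_right_mono norm_ge_zero order_trans)
  also have "\<dots> = (x - y) \<bullet> (x - y)"
    by (simp add: dot_square_norm power2_eq_square)
  finally show ?thesis
    by (simp add: inner_diff_left)
qed

text \<open>
  Scaling \<open>T\<close> by \<open>l\<^sub>n / (l\<^sub>n + 1)\<close> makes it a contraction, whose fixed point \<open>X\<^sub>n\<close> has displacement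
  \<open>y\<^sub>n = - X\<^sub>n / l\<^sub>n\<close>; these are the resolvents of the monotone operator \<open>Id - T\<close>. Monotonicity between
  two of the points gives \<open>\<parallel>y\<^sub>m - y\<^sub>n\<parallel>\<^sup>2 \<le> \<parallel>y\<^sub>m\<parallel>\<^sup>2 - \<parallel>y\<^sub>n\<parallel>\<^sup>2\<close> for \<open>m < n\<close>, so the norms decrease and
  \<open>y\<close> is Cauchy. Monotonicity between \<open>X\<^sub>n\<close> and a fixed \<open>u\<close> gives the inequality for the limit.
\<close>

lemma ex_variational_displacement:
  fixes T :: "'b::real_inner \<Rightarrow> 'b"
  assumes H: "subspace H" "Topological_Spaces.complete H"
    and TH: "T \<in> H \<rightarrow> H" and T: "1-lipschitz_on H T"
  obtains v where "v \<in> closure ((\<lambda>x. x - T x) ` H)"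
    and "\<And>u. u \<in> H \<Longrightarrow> (norm v)\<^sup>2 \<le> (u - T u) \<bullet> v"
proof -
  define l :: "nat \<Rightarrow> real" where "l = (\<lambda>n. real n + 1)"
  have l: "l n > 0" for n by (simp add: l_def)
  have "\<exists>x\<in>H. x = - (l n *\<^sub>R (x - T x))" for n
  proof -
    let ?c = "l n / (l n + 1)"
    have "\<exists>!x. x \<in> H \<and> ?c *\<^sub>R T x = x"
    proof (rule Banach_fix[OF H(2)])
      show "H \<noteq> {}" using H(1) subspace_0 by blast
      show "0 \<le> ?c" "?c < 1" using l[of n] by auto
      show "(\<lambda>x. ?c *\<^sub>R T x) ` H \<subseteq> H"
        using TH H(1) by (auto intro: subspace_scale)
      fix x y assume "x \<in> H" "y \<in> H"
      then have "norm (T x - T y) \<le> norm (x - y)"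
        using lipschitz_onD[OF T] by (fastforce simp add: dist_norm)
      then show "dist (?c *\<^sub>R T x) (?c *\<^sub>R T y) \<le> ?c * dist x y"
        using l[of n] by (simp add: dist_norm flip: scaleR_diff_right)
          (intro divide_right_mono mult_left_mono; simp)
    qed
    then obtain x where x: "x \<in> H" "?c *\<^sub>R T x = x" by blast
    have "(l n + 1) *\<^sub>R x = l n *\<^sub>R T x"
      using l[of n] by (subst x(2)[symmetric]) simp
    then have "x = - (l n *\<^sub>R (x - T x))"
      by (simp add: algebra_simps)
    then show ?thesis using x(1) by blast
  qed
  then obtain X where X: "\<And>n. X n \<in> H" "\<And>n. X n = - (l n *\<^sub>R (X n - T (X n)))"
    by metis
  define y where "y = (\<lambda>n. X n - T (X n))"
  have Xy: "X n = - (l n *\<^sub>R y n)" for n using X(2) by (simp add: y_def)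
  have yH: "y n \<in> H" for n
    unfolding y_def using X(1) TH H(1) by (auto intro: subspace_diff)
  have key: "(norm (y m - y n))\<^sup>2 \<le> (norm (y m))\<^sup>2 - (norm (y n))\<^sup>2" if "m < n" for m n
  proof -
    have mono: "(y m - y n) \<bullet> (l m *\<^sub>R y m - l n *\<^sub>R y n) \<le> 0"
    proof -
      have "0 \<le> (y m - y n) \<bullet> (X m - X n)"
        using nonexpansive_displacement_monotone[OF T X(1)[of m] X(1)[of n]] by (simp add: y_def)
      also have "X m - X n = - (l m *\<^sub>R y m - l n *\<^sub>R y n)"
        by (subst (1 2) Xy) simp
      finally show ?thesis by (simp only: inner_minus_right neg_0_le_iff_le)
    qed
    have "l m * (norm (y m - y n))\<^sup>2 + (y m - y n) \<bullet> (l m *\<^sub>R y n - l n *\<^sub>R y n) \<le> 0"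
      using mono by (simp add: power2_norm_eq_inner algebra_simps)
    then have A: "l m * (norm (y m - y n))\<^sup>2 \<le> (l n - l m) * ((y m - y n) \<bullet> y n)"
      by (simp add: algebra_simps)
    have "0 \<le> l m * (norm (y m - y n))\<^sup>2" using l[of m] by simp
    with A have "0 \<le> (l n - l m) * ((y m - y n) \<bullet> y n)" by linarith
    then have "0 \<le> (y m - y n) \<bullet> y n"
      using that by (simp add: l_def zero_le_mult_iff)
    then show ?thesis
      by (simp add: power2_norm_eq_inner algebra_simps inner_commute)
  qed
  have "decseq (\<lambda>n. (norm (y n))\<^sup>2)"
  proof (rule decseq_SucI)
    fix n show "(norm (y (Suc n)))\<^sup>2 \<le> (norm (y n))\<^sup>2"
      using order_trans[OF zero_le_power2 key[of n "Suc n"]] by simp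
  qed
  then have "Cauchy (\<lambda>n. (norm (y n))\<^sup>2)"
    by (intro convergent_Cauchy Bseq_monoseq_convergent decseq_imp_monoseq)
      (auto intro!: decseq_bounded[where B=0])
  have "Cauchy y"
    unfolding Cauchy_altdef
  proof (intro allI impI)
    fix e :: real assume "e > 0"
    then have "e\<^sup>2 > 0" by simp
    then obtain N where N: "\<And>m n. m \<ge> N \<Longrightarrow> n > m \<Longrightarrow> dist ((norm (y m))\<^sup>2) ((norm (y n))\<^sup>2) < e\<^sup>2"
      using \<open>Cauchy (\<lambda>n. _)\<close> unfolding Cauchy_altdef by metis
    have "dist (y m) (y n) < e" if "m \<ge> N" "n > m" for m n
    proof -
      have "(norm (y m - y n))\<^sup>2 < e\<^sup>2"
        using key[OF that(2)] N[OF that] by (simp add: dist_real_def abs_less_iff)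
      then show ?thesis using \<open>e > 0\<close> by (simp add: dist_norm power2_less_imp_less)
    qed
    then show "\<exists>M. \<forall>m\<ge>M. \<forall>n>m. dist (y m) (y n) < e" by blast
  qed
  then obtain v where v: "y \<longlonglongrightarrow> v"
    using H(2) yH unfolding complete_def by blast
  show thesis
  proof
    show "v \<in> closure ((\<lambda>x. x - T x) ` H)"
      unfolding closure_sequential
    proof (intro exI conjI allI)
      show "y n \<in> (\<lambda>x. x - T x) ` H" for n using X(1) by (simp add: y_def)
    qed (rule v)
    fix u assume u: "u \<in> H"
    have ineq: "(norm (y n))\<^sup>2 \<le> (u - T u) \<bullet> y n + ((u - T u - y n) \<bullet> u) / l n" for n
    proof -
      have "0 \<le> (y n - (u - T u)) \<bullet> (X n - u)"
        using nonexpansive_displacement_monotone[OF T X(1)[of n] u] by (simp add: y_def)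
      then have "0 \<le> (y n - (u - T u)) \<bullet> (- (l n *\<^sub>R y n) - u)"
        by (simp only: Xy[of n])
      then have "l n * (norm (y n))\<^sup>2 \<le> l n * ((u - T u) \<bullet> y n) + (u - T u - y n) \<bullet> u"
        by (simp add: power2_norm_eq_inner inner_diff_left inner_diff_right algebra_simps)
      then show ?thesis using l[of n] by (simp add: field_simps)
    qed
    have "(\<lambda>n. ((u - T u - y n) \<bullet> u) / l n) \<longlonglongrightarrow> 0"
    proof -
      have "(\<lambda>n. ((u - T u - y n) \<bullet> u) * (1 / l n)) \<longlonglongrightarrow> ((u - T u - v) \<bullet> u) * 0"
        unfolding l_def using LIMSEQ_inverse_real_of_nat
        by (intro tendsto_intros v) (simp add: inverse_eq_divide add.commute)
      then show ?thesis by simp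
    qed
    with tendsto_inner[OF tendsto_const[of "u - T u"] v]
    have "(\<lambda>n. (u - T u) \<bullet> y n + ((u - T u - y n) \<bullet> u) / l n) \<longlonglongrightarrow> (u - T u) \<bullet> v + 0"
      by (rule tendsto_add)
    moreover have "(\<lambda>n. (norm (y n))\<^sup>2) \<longlonglongrightarrow> (norm v)\<^sup>2" by (intro tendsto_intros v)
    ultimately have "(norm v)\<^sup>2 \<le> (u - T u) \<bullet> v + 0"
      using ineq by (intro LIMSEQ_le) auto
    then show "(norm v)\<^sup>2 \<le> (u - T u) \<bullet> v" by simp
  qed
qed

text \<open>
  The half-space \<open>{u. \<parallel>v\<parallel>\<^sup>2 \<le> \<langle>u, v\<rangle>}\<close> is closed, so it contains the closure of \<open>R\<close>; its point
  nearest to the origin is \<open>v\<close>, and no other.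
\<close>

lemma variational_minimum_norm:
  fixes v :: "'b::real_inner"
  assumes "\<And>u. u \<in> R \<Longrightarrow> (norm v)\<^sup>2 \<le> u \<bullet> v" and w: "w \<in> closure R"
  shows "norm v \<le> norm w" and "norm w \<le> norm v \<Longrightarrow> w = v"
proof -
  have "closed {u. (norm v)\<^sup>2 \<le> u \<bullet> v}"
    by (intro closed_Collect_le continuous_intros)
  then have "closure R \<subseteq> {u. (norm v)\<^sup>2 \<le> u \<bullet> v}"
    using assms(1) by (intro closure_minimal) auto
  with w have *: "(norm v)\<^sup>2 \<le> w \<bullet> v" by blast
  have "(norm (w - v))\<^sup>2 = (norm w)\<^sup>2 - 2 * (w \<bullet> v) + (norm v)\<^sup>2"
    by (simp add: power2_norm_eq_inner algebra_simps inner_commute)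
  with * have d: "(norm (w - v))\<^sup>2 \<le> (norm w)\<^sup>2 - (norm v)\<^sup>2" by simp
  have "(norm v)\<^sup>2 \<le> (norm w)\<^sup>2" using order_trans[OF zero_le_power2 d] by linarith
  then show "norm v \<le> norm w" using power2_le_imp_le by auto
  assume "norm w \<le> norm v"
  then have "(norm w)\<^sup>2 \<le> (norm v)\<^sup>2" by (simp add: power_mono)
  with d have "(norm (w - v))\<^sup>2 \<le> 0" by linarith
  then show "w = v" by simp
qed

lemma infimal_displacement_eqI:
  fixes v :: "'b::real_inner"
  assumes "v \<in> closure ((\<lambda>x. x - T x) ` H)"
    and "\<And>u. u \<in> H \<Longrightarrow> (norm v)\<^sup>2 \<le> (u - T u) \<bullet> v"
  shows "infimal_displacement H T = v"
  unfolding infimal_displacement_def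
proof (rule the_equality)
  have R: "\<And>u. u \<in> (\<lambda>x. x - T x) ` H \<Longrightarrow> (norm v)\<^sup>2 \<le> u \<bullet> v"
    using assms(2) by blast
  note min = variational_minimum_norm[OF R]
  show "v \<in> closure ((\<lambda>x. x - T x) ` H) \<and>
      (\<forall>w\<in>closure ((\<lambda>x. x - T x) ` H). norm v \<le> norm w)"
    using assms(1) min(1) by blast
  show "w = v" if "w \<in> closure ((\<lambda>x. x - T x) ` H) \<and>
      (\<forall>u\<in>closure ((\<lambda>x. x - T x) ` H). norm w \<le> norm u)" for w
    using assms(1) min(2) that by blast
qed

section \<open>Average displacement of a non-expansive iteration\<close>

lemma funpow_in:
  assumes "U \<in> H \<rightarrow> H" "z \<in> H"
  shows "(U ^^ n) z \<in> H"
  using assms by (induction n) auto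

lemma nonexpansive_funpow_dist:
  fixes U :: "'b::real_normed_vector \<Rightarrow> 'b"
  assumes "U \<in> H \<rightarrow> H" and U: "1-lipschitz_on H U" and "z \<in> H" "u \<in> H"
  shows "norm ((U ^^ n) z - (U ^^ n) u) \<le> norm (z - u)"
proof (induction n)
  case (Suc n)
  have "norm (U ((U ^^ n) z) - U ((U ^^ n) u)) \<le> norm ((U ^^ n) z - (U ^^ n) u)"
    using lipschitz_onD[OF U funpow_in[OF assms(1,3)] funpow_in[OF assms(1,4)]]
    by (simp add: dist_norm)
  with Suc show ?case by simp
qed simp

lemma nonexpansive_displacement_decreasing:
  fixes U :: "'b::real_normed_vector \<Rightarrow> 'b"
  assumes "U \<in> H \<rightarrow> H" "1-lipschitz_on H U" "z \<in> H"
  shows "norm ((U ^^ n) z - U ((U ^^ n) z)) \<le> norm (z - U z)"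
  using nonexpansive_funpow_dist[OF assms(1,2,3), of "U z" n] assms
  by (auto simp: funpow_swap1)

text \<open>
  Pazy's theorem. The average displacement \<open>a\<^sub>n = (z - U\<^sup>n z) / n\<close> is a mean of displacements, so it
  inherits \<open>\<parallel>v\<parallel>\<^sup>2 \<le> \<langle>a\<^sub>n, v\<rangle>\<close>, whence \<open>\<parallel>a\<^sub>n - v\<parallel>\<^sup>2 \<le> \<parallel>a\<^sub>n\<parallel>\<^sup>2 - \<parallel>v\<parallel>\<^sup>2\<close>. It remains to bound
  \<open>\<parallel>a\<^sub>n\<parallel>\<close> from above by nearly \<open>\<parallel>v\<parallel>\<close>: replacing \<open>z\<close> by a point \<open>u\<close> with displacement close to \<open>v\<close>
  changes \<open>a\<^sub>n\<close> only by \<open>O(1 / n)\<close>, and from \<open>u\<close> no later displacement is longer than the first.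
\<close>

lemma nonexpansive_average_displacement:
  fixes U :: "'b::real_inner \<Rightarrow> 'b"
  assumes UH: "U \<in> H \<rightarrow> H" and U: "1-lipschitz_on H U" and z: "z \<in> H"
    and v: "v \<in> closure ((\<lambda>x. x - U x) ` H)"
    and var: "\<And>u. u \<in> H \<Longrightarrow> (norm v)\<^sup>2 \<le> (u - U u) \<bullet> v"
  shows "(\<lambda>n. (U ^^ n) z /\<^sub>R real n) \<longlonglongrightarrow> - v"
proof -
  define a where "a = (\<lambda>n. (z - (U ^^ n) z) /\<^sub>R real n)"
  have tele: "z - (U ^^ n) z = (\<Sum>k<n. (U ^^ k) z - U ((U ^^ k) z))" for n z
    by (induction n) (simp_all add: algebra_simps)
  have a_v: "(norm (a n - v))\<^sup>2 \<le> (norm (a n))\<^sup>2 - (norm v)\<^sup>2" if "n > 0" for n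
  proof -
    have "real n * (norm v)\<^sup>2 = (\<Sum>k<n. (norm v)\<^sup>2)" by simp
    also have "\<dots> \<le> (\<Sum>k<n. ((U ^^ k) z - U ((U ^^ k) z)) \<bullet> v)"
      by (intro sum_mono var funpow_in[OF UH z])
    also have "\<dots> = real n * (a n \<bullet> v)"
      using that unfolding a_def tele by (simp add: inner_sum_left)
    finally have "(norm v)\<^sup>2 \<le> a n \<bullet> v" using that by simp
    moreover have "(norm (a n - v))\<^sup>2 = (norm (a n))\<^sup>2 - 2 * (a n \<bullet> v) + (norm v)\<^sup>2"
      by (simp add: power2_norm_eq_inner algebra_simps inner_commute)
    ultimately show ?thesis by simp
  qed
  have a_le: "norm (a n) \<le> norm (u - U u) + 2 * norm (z - u) / real n" if "n > 0" "u \<in> H" for n u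
  proof -
    have "norm (u - (U ^^ n) u) \<le> (\<Sum>k<n. norm (u - U u))"
      unfolding tele
      by (intro sum_norm_le nonexpansive_displacement_decreasing[OF UH U] that)
    then have 1: "norm (u - (U ^^ n) u) \<le> real n * norm (u - U u)" by simp
    have "z - (U ^^ n) z = (z - u) + (u - (U ^^ n) u) + ((U ^^ n) u - (U ^^ n) z)" by simp
    then have "norm (z - (U ^^ n) z)
        \<le> norm (z - u) + norm (u - (U ^^ n) u) + norm ((U ^^ n) u - (U ^^ n) z)"
      by (metis norm_triangle_ineq norm_triangle_le add_mono order_refl)
    also have "\<dots> \<le> real n * norm (u - U u) + 2 * norm (z - u)"
      using 1 nonexpansive_funpow_dist[OF UH U z that(2), of n] by (simp add: norm_minus_commute)
    finally have "norm (a n) \<le> (real n * norm (u - U u) + 2 * norm (z - u)) / real n"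
      by (simp add: a_def divide_inverse mult.commute mult_left_mono)
    then show ?thesis using that(1) by (simp add: field_simps)
  qed
  have na: "(\<lambda>n. (norm (a n))\<^sup>2) \<longlonglongrightarrow> (norm v)\<^sup>2"
  proof -
    have "(\<lambda>n. norm (a n)) \<longlonglongrightarrow> norm v"
    proof (rule LIMSEQ_I)
      fix r :: real assume "r > 0"
      then obtain u where u: "u \<in> H" "dist (u - U u) v < r / 2"
        using v half_gt_zero[of r] unfolding closure_approachable by blast
      have "(\<lambda>n. 2 * norm (z - u) / real n) \<longlonglongrightarrow> 0"
        using lim_const_over_n[of "2 * norm (z - u)"] by simp
      then have "eventually (\<lambda>n. 2 * norm (z - u) / real n < r / 2) sequentially"
        using \<open>r > 0\<close> by (intro order_tendstoD(2)) auto
      then have "eventually (\<lambda>n. norm (norm (a n) - norm v) < r) sequentially"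
        using eventually_gt_at_top[of 0]
      proof eventually_elim
        case (elim n)
        have "norm (u - U u) < norm v + r / 2"
          using u(2) norm_triangle_sub[of "u - U u" v] by (simp add: dist_norm)
        then have "norm (a n) < norm v + r" using a_le[OF elim(2) u(1)] elim(1) by linarith
        moreover have "norm v \<le> norm (a n)"
          using order_trans[OF zero_le_power2 a_v[OF elim(2)]]
          by (intro power2_le_imp_le[OF _ norm_ge_zero]) linarith
        ultimately show ?case by simp
      qed
      then show "\<exists>no. \<forall>n\<ge>no. norm (norm (a n) - norm v) < r"
        by (simp add: eventually_sequentially)
    qed
    then show ?thesis by (rule tendsto_power)
  qed
  have "(\<lambda>n. (norm (a n - v))\<^sup>2) \<longlonglongrightarrow> 0"
  proof (rule tendsto_sandwich[where f="\<lambda>_. 0"])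
    show "eventually (\<lambda>n. (norm (a n - v))\<^sup>2 \<le> (norm (a n))\<^sup>2 - (norm v)\<^sup>2) sequentially"
      using eventually_gt_at_top[of 0] by eventually_elim (rule a_v)
    show "(\<lambda>n. (norm (a n))\<^sup>2 - (norm v)\<^sup>2) \<longlonglongrightarrow> 0"
      using tendsto_diff[OF na tendsto_const[of "(norm v)\<^sup>2"]] by (simp only: diff_self)
  qed auto
  then have "(\<lambda>n. norm (a n - v)) \<longlonglongrightarrow> 0"
    using tendsto_real_sqrt[of "\<lambda>n. (norm (a n - v))\<^sup>2" 0] by simp
  then have a: "a \<longlonglongrightarrow> v" by (rule LIM_zero_cancel[OF tendsto_norm_zero_cancel])
  have "(\<lambda>n. z /\<^sub>R real n) \<longlonglongrightarrow> 0"
    using tendsto_scaleR[OF lim_inverse_n tendsto_const[of z]] by simp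
  then have "(\<lambda>n. z /\<^sub>R real n - a n) \<longlonglongrightarrow> 0 - v" using a by (rule tendsto_diff)
  then show ?thesis by (simp add: a_def algebra_simps)
qed

section \<open>Averaged operators and one block-selected step\<close>

lemma lipschitz_on_relaxation:
  fixes C :: "'b::real_normed_vector \<Rightarrow> 'b"
  assumes C: "1-lipschitz_on H C" and "0 \<le> t" "t \<le> 1"
  shows "1-lipschitz_on H (\<lambda>x. (1 - t) *\<^sub>R x + t *\<^sub>R C x)"
proof (rule lipschitz_onI)
  fix x y assume "x \<in> H" "y \<in> H"
  then have C: "norm (C x - C y) \<le> norm (x - y)"
    using lipschitz_onD[OF C] by (fastforce simp: dist_norm)
  have "norm (((1 - t) *\<^sub>R x + t *\<^sub>R C x) - ((1 - t) *\<^sub>R y + t *\<^sub>R C y))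
      = norm ((1 - t) *\<^sub>R (x - y) + t *\<^sub>R (C x - C y))"
    by (simp add: algebra_simps)
  also have "\<dots> \<le> (1 - t) * norm (x - y) + t * norm (C x - C y)"
    using assms(2,3) by (intro norm_triangle_le) simp
  also have "\<dots> \<le> (1 - t) * norm (x - y) + t * norm (x - y)"
    using assms(2) C by (intro add_left_mono mult_left_mono) auto
  finally show "dist ((1 - t) *\<^sub>R x + t *\<^sub>R C x) ((1 - t) *\<^sub>R y + t *\<^sub>R C y) \<le> 1 * dist x y"
    by (simp add: dist_norm algebra_simps)
qed simp

lemma averaged_on_imp_nonexpansive:
  fixes T :: "'b::real_normed_vector \<Rightarrow> 'b"
  assumes "averaged_on \<theta> H T" "0 \<le> \<theta>" "\<theta> \<le> 1"
  shows "1-lipschitz_on H T"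
proof -
  obtain C where "1-lipschitz_on H C" and T: "\<forall>x\<in>H. T x = (1 - \<theta>) *\<^sub>R x + \<theta> *\<^sub>R C x"
    using assms(1) unfolding averaged_on_def by blast
  then have "1-lipschitz_on H (\<lambda>x. (1 - \<theta>) *\<^sub>R x + \<theta> *\<^sub>R C x)"
    using lipschitz_on_relaxation assms(2,3) by blast
  then show ?thesis using T by (simp add: lipschitz_on_def)
qed

text \<open>
  With \<open>T = (1 - \<theta>) Id + \<theta> C\<close> the displacement is \<open>\<theta> (Id - C)\<close>, and \<open>Id - C\<close> is \<open>1/2\<close>-cocoercive:
  expand \<open>\<parallel>C x - C y\<parallel>\<^sup>2 \<le> \<parallel>x - y\<parallel>\<^sup>2\<close> after writing \<open>C x - C y\<close> as \<open>x - y\<close> minus the difference of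
  the values of \<open>Id - C\<close>.
\<close>

lemma averaged_on_displacement_cocoercive:
  fixes T :: "'b::real_inner \<Rightarrow> 'b"
  assumes "averaged_on \<theta> H T" and "x \<in> H" "y \<in> H"
  shows "(norm ((x - T x) - (y - T y)))\<^sup>2 \<le> 2 * \<theta> * (((x - T x) - (y - T y)) \<bullet> (x - y))"
proof -
  obtain C where C: "1-lipschitz_on H C" and T: "\<And>x. x \<in> H \<Longrightarrow> T x = (1 - \<theta>) *\<^sub>R x + \<theta> *\<^sub>R C x"
    using assms(1) unfolding averaged_on_def by blast
  let ?e = "(x - y) - (C x - C y)"
  have "(norm (C x - C y))\<^sup>2 \<le> (norm (x - y))\<^sup>2"
    using lipschitz_onD[OF C assms(2,3)] by (simp add: dist_norm power_mono)
  then have e: "(norm ?e)\<^sup>2 \<le> 2 * (?e \<bullet> (x - y))"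
    unfolding power2_norm_eq_inner
    by (simp add: inner_diff_left inner_diff_right inner_commute)
  have D: "(x - T x) - (y - T y) = \<theta> *\<^sub>R ?e"
    by (simp add: T assms(2,3) algebra_simps)
  have "(norm (\<theta> *\<^sub>R ?e))\<^sup>2 = \<theta>\<^sup>2 * (norm ?e)\<^sup>2" by (simp add: power_mult_distrib)
  also have "\<dots> \<le> \<theta>\<^sup>2 * (2 * (?e \<bullet> (x - y)))" by (rule mult_left_mono[OF e]) simp
  also have "\<dots> = 2 * \<theta> * ((\<theta> *\<^sub>R ?e) \<bullet> (x - y))"
    by (simp add: power2_eq_square)
  finally show ?thesis by (simp only: D)
qed

text \<open>
  The left-hand side is what becomes of the bound in \<open>T_sel_squared_dist\<close> below when every
  coordinate of the selection is replaced by its mean \<open>\<alpha>\<close>; here \<open>r\<close> is the difference of the two points, and \<open>g\<close>,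
  \<open>h\<close> are the displacements there. With \<open>e = g - h\<close>, cocoercivity supplies the term
  \<open>- (\<alpha> / \<theta>) \<parallel>e\<parallel>\<^sup>2\<close>. Of this, \<open>- \<alpha> \<parallel>e\<parallel>\<^sup>2\<close> cancels the square of the step, and as \<open>\<theta> < 1\<close> the
  rest, \<open>- \<alpha> q \<parallel>e\<parallel>\<^sup>2\<close> with \<open>q = (1 - \<theta>) / \<theta>\<close>, absorbs the cross term in \<open>e\<close> and \<open>h\<close> by Young's
  inequality. Only a multiple of \<open>\<parallel>h\<parallel>\<^sup>2\<close> is left.
\<close>

lemma cocoercive_mean_step:
  fixes r g h :: "'b::real_inner"
  assumes co: "(norm (g - h))\<^sup>2 \<le> 2 * \<theta> * ((g - h) \<bullet> r)"
    and \<theta>: "0 < \<theta>" "\<theta> < 1" and \<alpha>: "0 \<le> \<alpha>" "\<alpha> \<le> 1"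
  shows "(norm r)\<^sup>2 + 2 * \<alpha> * (r \<bullet> h) + \<alpha>\<^sup>2 * (norm h)\<^sup>2
      + \<alpha> * ((norm g)\<^sup>2 - 2 * \<alpha> * (g \<bullet> h) - 2 * (r \<bullet> g))
    \<le> (norm r)\<^sup>2 + (norm h)\<^sup>2 / (1 - \<theta>)"
proof -
  define e where "e = g - h"
  define a b where "a = norm e" and "b = norm h"
  define q where "q = (1 - \<theta>) / \<theta>"
  have q: "q > 0" using \<theta> by (simp add: q_def)
  have g: "g = e + h" by (simp add: e_def)
  have "(norm e)\<^sup>2 / \<theta> \<le> 2 * (e \<bullet> r)"
    using co \<theta> by (simp add: e_def field_simps)
  moreover have "(norm e)\<^sup>2 / \<theta> = (norm e)\<^sup>2 + q * (norm e)\<^sup>2"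
    using \<theta> by (simp add: q_def field_simps)
  ultimately have "\<alpha> * (a\<^sup>2 + q * a\<^sup>2) \<le> \<alpha> * (2 * (e \<bullet> r))"
    using \<alpha> by (intro mult_left_mono) (auto simp: a_def)
  moreover have eh: "e \<bullet> h \<le> a * b" unfolding a_def b_def by (rule norm_cauchy_schwarz)
  have "2 * \<alpha> * (1 - \<alpha>) * (e \<bullet> h) \<le> 2 * \<alpha> * (1 - \<alpha>) * (a * b)"
    using \<alpha> by (intro mult_left_mono[OF eh]) auto
  moreover have "2 * (a * b) * (1 - \<alpha>) \<le> q * a\<^sup>2 + b\<^sup>2 / q"
  proof -
    have "2 * (a * b) * (1 - \<alpha>) \<le> 2 * (a * b) * 1"
      using \<alpha> by (intro mult_left_mono) (auto simp: a_def b_def)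
    moreover have "0 \<le> (q * a - b)\<^sup>2 / q" using q by simp
    moreover have "(q * a - b)\<^sup>2 / q = q * a\<^sup>2 - 2 * (a * b) + b\<^sup>2 / q"
      using q by (simp add: power2_eq_square field_simps)
    ultimately show ?thesis by linarith
  qed
  then have "\<alpha> * (2 * (a * b) * (1 - \<alpha>)) \<le> \<alpha> * (q * a\<^sup>2 + b\<^sup>2 / q)"
    using \<alpha> by (intro mult_left_mono) auto
  moreover have "\<alpha> * (b\<^sup>2 / q) \<le> 1 * (b\<^sup>2 / q)"
    using \<alpha> q by (intro mult_right_mono) auto
  moreover have "\<alpha> * (1 - \<alpha>) * b\<^sup>2 \<le> 1 * b\<^sup>2"
    using \<alpha> by (intro mult_right_mono mult_le_one) auto
  moreover have "b\<^sup>2 / (1 - \<theta>) = b\<^sup>2 / q + b\<^sup>2"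
    using \<theta> by (simp add: q_def field_simps)
  moreover have "2 * \<alpha> * (r \<bullet> h) + \<alpha>\<^sup>2 * (norm h)\<^sup>2
      + \<alpha> * ((norm g)\<^sup>2 - 2 * \<alpha> * (g \<bullet> h) - 2 * (r \<bullet> g))
    = \<alpha> * a\<^sup>2 - \<alpha> * (2 * (e \<bullet> r)) + 2 * \<alpha> * (1 - \<alpha>) * (e \<bullet> h) + \<alpha> * (1 - \<alpha>) * b\<^sup>2"
    unfolding g a_def b_def power2_norm_eq_inner
    by (simp add: inner_add_left inner_add_right inner_commute power2_eq_square algebra_simps)
  ultimately show ?thesis
    unfolding b_def[symmetric] by (simp add: algebra_simps)
qed

lemma T_sel_nth:
  assumes "\<theta> \<noteq> 0"
  shows "T_sel \<theta> T s x $ i = x $ i - (s $ i) *\<^sub>R ((x - T x) $ i)"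
proof -
  have "(\<Sum>j\<in>UNIV. (s $ j) *\<^sub>R axis j (S_op \<theta> T x $ j) $ i) = (s $ i) *\<^sub>R (S_op \<theta> T x $ i)"
    by (subst sum.remove[of _ i]) (auto simp: axis_def intro!: sum.neutral)
  then show ?thesis
    using assms by (simp add: T_sel_def S_sel_def S_block_def S_op_def sum_component)
qed

text \<open>
  Expanding the square produces \<open>(s $ i)\<^sup>2\<close>, about whose mean nothing is known. Bounding it by
  \<open>s $ i\<close> leaves an expression that is affine in the selection, so that its mean depends only
  on \<open>\<alpha>\<close>.
\<close>

lemma T_sel_squared_dist:
  fixes T :: "'a::real_inner ^ 'm::finite \<Rightarrow> 'a ^ 'm"
  assumes "\<theta> \<noteq> 0" and s: "\<And>i. s $ i \<in> {0..1}"
  shows "(norm (T_sel \<theta> T s x - (z - \<alpha> *\<^sub>R h)))\<^sup>2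
    \<le> (norm (x - z))\<^sup>2 + 2 * \<alpha> * ((x - z) \<bullet> h) + \<alpha>\<^sup>2 * (norm h)\<^sup>2
      + (\<Sum>i\<in>UNIV. ((norm ((x - T x) $ i))\<^sup>2 - 2 * \<alpha> * ((x - T x) $ i \<bullet> h $ i)
          - 2 * ((x - z) $ i \<bullet> (x - T x) $ i)) * s $ i)"
proof -
  define r g where "r = x - z" and "g = x - T x"
  have nsq: "(norm y)\<^sup>2 = (\<Sum>i\<in>UNIV. (norm (y $ i))\<^sup>2)" for y :: "'a ^ 'm"
    by (simp add: power2_norm_eq_inner inner_vec_def)
  have "(norm (T_sel \<theta> T s x - (z - \<alpha> *\<^sub>R h)))\<^sup>2
      = (\<Sum>i\<in>UNIV. (norm (r $ i - (s $ i) *\<^sub>R g $ i + \<alpha> *\<^sub>R h $ i))\<^sup>2)"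
    unfolding nsq by (simp add: T_sel_nth assms(1) r_def g_def algebra_simps)
  also have "\<dots> \<le> (\<Sum>i\<in>UNIV. (norm (r $ i))\<^sup>2 + 2 * \<alpha> * (r $ i \<bullet> h $ i) + \<alpha>\<^sup>2 * (norm (h $ i))\<^sup>2
      + ((norm (g $ i))\<^sup>2 - 2 * \<alpha> * (g $ i \<bullet> h $ i) - 2 * (r $ i \<bullet> g $ i)) * s $ i)"
  proof (rule sum_mono)
    fix i
    have "s $ i * s $ i \<le> s $ i * 1" using s[of i] by (intro mult_left_mono) auto
    then have "s $ i * s $ i * (g $ i \<bullet> g $ i) \<le> s $ i * (g $ i \<bullet> g $ i)"
      by (intro mult_right_mono) auto
    then show "(norm (r $ i - (s $ i) *\<^sub>R g $ i + \<alpha> *\<^sub>R h $ i))\<^sup>2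
      \<le> (norm (r $ i))\<^sup>2 + 2 * \<alpha> * (r $ i \<bullet> h $ i) + \<alpha>\<^sup>2 * (norm (h $ i))\<^sup>2
      + ((norm (g $ i))\<^sup>2 - 2 * \<alpha> * (g $ i \<bullet> h $ i) - 2 * (r $ i \<bullet> g $ i)) * s $ i"
      unfolding power2_norm_eq_inner
      by (simp add: inner_add_left inner_add_right inner_diff_left inner_diff_right
          inner_commute power2_eq_square algebra_simps)
  qed
  also have "\<dots> = (norm r)\<^sup>2 + 2 * \<alpha> * (r \<bullet> h) + \<alpha>\<^sup>2 * (norm h)\<^sup>2
      + (\<Sum>i\<in>UNIV. ((norm (g $ i))\<^sup>2 - 2 * \<alpha> * (g $ i \<bullet> h $ i) - 2 * (r $ i \<bullet> g $ i)) * s $ i)"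
    by (simp add: sum.distrib nsq inner_vec_def sum_distrib_left)
  finally show ?thesis by (simp only: r_def g_def)
qed

section \<open>Almost sure convergence of non-negative supermartingales\<close>

text \<open>
  The supermartingale property is demanded only on the events that the process has stayed below a
  level \<open>c\<close> since time \<open>n\<close>. This suffices for Ville's maximal inequality: the mean of the process
  frozen at \<open>c\<close> upon its first exit does not increase, hence the process ever reaches \<open>c\<close> after
  time \<open>n\<close> with probability at most \<open>E[Y\<^sub>n] / c\<close>. As the means tend to \<open>0\<close>, almost surely it stays below
  \<open>c\<close> eventually.
\<close>

lemma (in prob_space) supermartingale_AE_tendsto_0:
  fixes Y :: "nat \<Rightarrow> 'a \<Rightarrow> real"
  assumes int: "\<And>k. integrable M (Y k)"
    and nonneg: "\<And>k \<omega>. \<omega> \<in> space M \<Longrightarrow> 0 \<le> Y k \<omega>"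
    and super: "\<And>n k c. n \<le> k \<Longrightarrow>
      (\<integral>\<omega>. indicator {\<omega> \<in> space M. \<forall>i\<in>{n..k}. Y i \<omega> < c} \<omega> * Y (Suc k) \<omega> \<partial>M)
      \<le> (\<integral>\<omega>. indicator {\<omega> \<in> space M. \<forall>i\<in>{n..k}. Y i \<omega> < c} \<omega> * Y k \<omega> \<partial>M)"
    and lim: "(\<lambda>k. expectation (Y k)) \<longlonglongrightarrow> 0"
  shows "AE \<omega> in M. (\<lambda>k. Y k \<omega>) \<longlonglongrightarrow> 0"
proof -
  note [measurable] = borel_measurable_integrable[OF int]
  define A where "A = (\<lambda>n k c. {\<omega> \<in> space M. \<forall>i\<in>{n..k}. Y i \<omega> < c})"
  have A[measurable]: "A n k c \<in> events" for n k c
    unfolding A_def by measurable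
  have intA: "integrable M (\<lambda>\<omega>. indicator (A n k c) \<omega> * Y j \<omega>)" for n k c j
    using integrable_mult_indicator[OF A int] by simp
  have intC: "integrable M (\<lambda>\<omega>. c * indicator (space M - A n k c) \<omega> :: real)" for n k c
    by (intro integrable_mult_right integrable_real_indicator) (auto simp: emeasure_eq_measure)
  have split: "(\<integral>\<omega>. c * indicator (space M - A n k c) \<omega> + indicator (A n k c) \<omega> * Y j \<omega> \<partial>M)
      = c * prob (space M - A n k c) + (\<integral>\<omega>. indicator (A n k c) \<omega> * Y j \<omega> \<partial>M)" for n k c j
    by (subst Bochner_Integration.integral_add[OF intC intA]) simp
  have maximal: "c * prob (space M - A n k c) \<le> expectation (Y n)" if "n \<le> k" "c > 0" for n k c
  proof -
    have "c * prob (space M - A n k c) + (\<integral>\<omega>. indicator (A n k c) \<omega> * Y k \<omega> \<partial>M)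
        \<le> expectation (Y n)"
      using \<open>n \<le> k\<close>
    proof (induction k rule: dec_induct)
      case base
      have "c * prob (space M - A n n c) + (\<integral>\<omega>. indicator (A n n c) \<omega> * Y n \<omega> \<partial>M)
          = (\<integral>\<omega>. c * indicator (space M - A n n c) \<omega> + indicator (A n n c) \<omega> * Y n \<omega> \<partial>M)"
        by (simp only: split)
      also have "\<dots> \<le> expectation (Y n)"
        by (intro integral_mono Bochner_Integration.integrable_add intC intA int) (auto simp: A_def indicator_def)
      finally show ?case .
    next
      case (step k)
      have "c * prob (space M - A n (Suc k) c) + (\<integral>\<omega>. indicator (A n (Suc k) c) \<omega> * Y (Suc k) \<omega> \<partial>M)
          = (\<integral>\<omega>. c * indicator (space M - A n (Suc k) c) \<omega> + indicator (A n (Suc k) c) \<omega> * Y (Suc k) \<omega> \<partial>M)"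
        by (simp only: split)
      also have "\<dots> \<le> (\<integral>\<omega>. c * indicator (space M - A n k c) \<omega> + indicator (A n k c) \<omega> * Y (Suc k) \<omega> \<partial>M)"
        by (intro integral_mono Bochner_Integration.integrable_add intC intA) (auto simp: A_def indicator_def le_Suc_eq not_less)
      also have "\<dots> = c * prob (space M - A n k c) + (\<integral>\<omega>. indicator (A n k c) \<omega> * Y (Suc k) \<omega> \<partial>M)"
        by (simp only: split)
      also have "\<dots> \<le> c * prob (space M - A n k c) + (\<integral>\<omega>. indicator (A n k c) \<omega> * Y k \<omega> \<partial>M)"
        unfolding A_def using super step.hyps by simp
      finally show ?case using step.IH by linarith
    qed
    moreover have "0 \<le> (\<integral>\<omega>. indicator (A n k c) \<omega> * Y k \<omega> \<partial>M)"
      using nonneg by (intro integral_nonneg_AE AE_I2) (simp add: indicator_def)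
    ultimately show ?thesis by linarith
  qed
  have eventually_less: "AE \<omega> in M. \<exists>n. \<forall>k\<ge>n. Y k \<omega> < c" if "c > 0" for c
  proof -
    define E where "E = (\<lambda>n. \<Union>k. space M - A n k c)"
    have E[measurable]: "E n \<in> events" for n unfolding E_def by measurable
    have "c * prob (E n) \<le> expectation (Y n)" for n
    proof (rule LIMSEQ_le_const2)
      have "(\<lambda>k. prob (space M - A n k c)) \<longlonglongrightarrow> prob (E n)"
        unfolding E_def by (intro finite_Lim_measure_incseq) (auto simp: incseq_def A_def)
      then show "(\<lambda>k. c * prob (space M - A n k c)) \<longlonglongrightarrow> c * prob (E n)"
        by (intro tendsto_intros)
      show "\<exists>N. \<forall>k\<ge>N. c * prob (space M - A n k c) \<le> expectation (Y n)"
        using maximal \<open>c > 0\<close> by blast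
    qed
    moreover have "c * prob (\<Inter>n. E n) \<le> c * prob (E n)" for n
      using \<open>c > 0\<close> by (intro mult_left_mono finite_measure_mono) auto
    ultimately have "c * prob (\<Inter>n. E n) \<le> 0"
      using lim by (intro LIMSEQ_le_const[OF lim]) (meson order_trans)
    then have "prob (\<Inter>n. E n) = 0"
      using \<open>c > 0\<close> by (simp add: mult_le_0_iff measure_le_0_iff)
    then have "AE \<omega> in M. \<omega> \<notin> (\<Inter>n. E n)"
      by (intro AE_I[where N="\<Inter>n. E n"]) (auto simp: emeasure_eq_measure)
    then show ?thesis
    proof (rule AE_mp, intro AE_I2 impI)
      fix \<omega> assume "\<omega> \<in> space M" "\<omega> \<notin> (\<Inter>n. E n)"
      then obtain n where n: "\<forall>k. \<forall>i\<in>{n..k}. Y i \<omega> < c"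
        by (auto simp: E_def A_def)
      then have "\<forall>k\<ge>n. Y k \<omega> < c" by force
      then show "\<exists>n. \<forall>k\<ge>n. Y k \<omega> < c" by blast
    qed
  qed
  have "AE \<omega> in M. \<forall>m. \<exists>n. \<forall>k\<ge>n. Y k \<omega> < inverse (real (Suc m))"
    by (subst AE_all_countable) (intro allI eventually_less, simp)
  then show ?thesis
  proof (rule AE_mp, intro AE_I2 impI LIMSEQ_I)
    fix \<omega> and r :: real
    assume \<omega>: "\<omega> \<in> space M" and r: "0 < r"
      and Y: "\<forall>m. \<exists>n. \<forall>k\<ge>n. Y k \<omega> < inverse (real (Suc m))"
    obtain m where m: "inverse (real (Suc m)) < r" using reals_Archimedean[OF r] by blast
    obtain n where "\<forall>k\<ge>n. Y k \<omega> < inverse (real (Suc m))" using Y by blast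
    then show "\<exists>n. \<forall>k\<ge>n. norm (Y k \<omega> - 0) < r"
      using m nonneg[OF \<omega>] by (intro exI[of _ n]) (auto intro: less_trans)
  qed
qed

section \<open>Independent random selections\<close>

locale random_selections = prob_space M
  for M :: "'w measure" and I :: "nat \<Rightarrow> 'w \<Rightarrow> real ^ 'm::finite" and \<alpha> :: real +
  assumes indep: "indep_vars (\<lambda>_. borel) I UNIV"
    and selection: "\<And>k \<omega> i. \<omega> \<in> space M \<Longrightarrow> I k \<omega> $ i \<in> {0..1}"
    and mean: "\<And>k i. expectation (\<lambda>\<omega>. I k \<omega> $ i) = \<alpha>"
begin

definition selections :: "'w \<Rightarrow> nat \<Rightarrow> real ^ 'm" where
  "selections \<omega> = (\<lambda>k. I k \<omega>)"

lemma measurable_selection [measurable]: "I k \<in> borel_measurable M"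
  using indep unfolding indep_vars_def by auto

lemma measurable_selections [measurable]: "selections \<in> borel_measurable M"
  by (intro measurable_coordinatewise_then_product) (simp add: selections_def)

text \<open>
  By Tychonoff's theorem the sequences with values in the unit cube form a compact set, so a
  continuous function is bounded along the selections.
\<close>

lemma integrable_continuous_selections:
  fixes h :: "(nat \<Rightarrow> real ^ 'm) \<Rightarrow> real"
  assumes h: "continuous_on UNIV h"
  shows "integrable M (\<lambda>\<omega>. h (selections \<omega>))"
proof -
  let ?B = "PiE UNIV (\<lambda>_::nat. cbox 0 1 :: (real ^ 'm) set)"
  have "compactin (product_topology (\<lambda>_. euclidean) UNIV) ?B"
    by (simp add: compactin_PiE del: PiE_UNIV_domain)
  then have "compact ?B"
    by (simp only: euclidean_product_topology flip: compactin_euclidean_iff)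
  then have "bounded (h ` ?B)"
    by (intro compact_imp_bounded compact_continuous_image continuous_on_subset[OF h]) auto
  then obtain b where b: "\<And>s. s \<in> ?B \<Longrightarrow> norm (h s) \<le> b"
    unfolding bounded_iff by blast
  have [measurable]: "h \<in> borel_measurable borel"
    using h by (rule borel_measurable_continuous_onI)
  have "selections \<omega> \<in> ?B" if "\<omega> \<in> space M" for \<omega>
    using selection[OF that] by (auto simp: selections_def mem_box_cart)
  then have "AE \<omega> in M. norm (h (selections \<omega>)) \<le> b"
    by (intro AE_I2 b)
  then show ?thesis by (intro integrable_const_bound[where B=b]) measurable
qed

lemma integrable_indicator_selections:
  fixes h :: "(nat \<Rightarrow> real ^ 'm) \<Rightarrow> real"
  assumes [measurable]: "A \<in> sets borel" and h: "continuous_on UNIV h"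
  shows "integrable M (\<lambda>\<omega>. indicator A (selections \<omega>) * h (selections \<omega>))"
proof (rule Bochner_Integration.integrable_bound[OF integrable_continuous_selections[OF h]])
  have [measurable]: "h \<in> borel_measurable borel"
    using h by (rule borel_measurable_continuous_onI)
  show "(\<lambda>\<omega>. indicator A (selections \<omega>) * h (selections \<omega>)) \<in> borel_measurable M" by measurable
qed (auto simp: indicator_def)

lemma integrable_selection: "integrable M (\<lambda>\<omega>. I k \<omega> $ i)"
  using integrable_continuous_selections[of "\<lambda>s. s k $ i"]
  by (simp add: selections_def continuous_intros)

lemma expectation_mult_selection:
  fixes f :: "(nat \<Rightarrow> real ^ 'm) \<Rightarrow> real"
  assumes f[measurable]: "f \<in> borel_measurable borel"
    and past: "\<And>s t. (\<And>j. j < k \<Longrightarrow> s j = t j) \<Longrightarrow> f s = f t"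
    and int: "integrable M (\<lambda>\<omega>. f (selections \<omega>))"
  shows "integrable M (\<lambda>\<omega>. f (selections \<omega>) * I k \<omega> $ i)"
    and "expectation (\<lambda>\<omega>. f (selections \<omega>) * I k \<omega> $ i) = \<alpha> * expectation (\<lambda>\<omega>. f (selections \<omega>))"
proof -
  \<comment> \<open>Independence is available for finite restrictions of the sequence of selections. As \<open>f\<close> sees
    only the first \<open>k\<close> entries, it factors through that restriction, padded with zeros.\<close>
  define F where "F = (\<lambda>s. f (\<lambda>j. if j < k then s j else 0))"
  have "(\<lambda>s j. if j < k then s j else 0) \<in> measurable (PiM {..<k} (\<lambda>_. borel :: (real ^ 'm) measure)) borel"
  proof (rule measurable_coordinatewise_then_product)
    show "(\<lambda>s. if j < k then s j else 0) \<in> borel_measurable (PiM {..<k} (\<lambda>_. borel :: (real ^ 'm) measure))" for j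
      by (cases "j < k") auto
  qed
  then have F: "F \<in> borel_measurable (PiM {..<k} (\<lambda>_. borel))"
    unfolding F_def by measurable
  have P: "(\<lambda>s. s k $ i) \<in> borel_measurable (PiM {k} (\<lambda>_. borel :: (real ^ 'm) measure))"
  proof (rule measurable_compose[OF measurable_component_singleton])
    show "(\<lambda>v :: real ^ 'm. v $ i) \<in> borel_measurable borel"
      by (intro borel_measurable_continuous_onI continuous_intros)
  qed simp
  have "indep_var (PiM {..<k} (\<lambda>_. borel)) (\<lambda>\<omega>. restrict (\<lambda>j. I j \<omega>) {..<k})
      (PiM {k} (\<lambda>_. borel)) (\<lambda>\<omega>. restrict (\<lambda>j. I j \<omega>) {k})"
    by (intro indep_var_restrict[OF indep]) auto
  then have "indep_var borel (F \<circ> (\<lambda>\<omega>. restrict (\<lambda>j. I j \<omega>) {..<k}))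
      borel ((\<lambda>s. s k $ i) \<circ> (\<lambda>\<omega>. restrict (\<lambda>j. I j \<omega>) {k}))"
    using F P by (rule indep_var_compose)
  moreover have "F \<circ> (\<lambda>\<omega>. restrict (\<lambda>j. I j \<omega>) {..<k}) = (\<lambda>\<omega>. f (selections \<omega>))"
    by (auto simp: F_def selections_def fun_eq_iff intro!: past)
  moreover have "(\<lambda>s. s k $ i) \<circ> (\<lambda>\<omega>. restrict (\<lambda>j. I j \<omega>) {k}) = (\<lambda>\<omega>. I k \<omega> $ i)"
    by (auto simp: fun_eq_iff)
  ultimately have iv: "indep_var borel (\<lambda>\<omega>. f (selections \<omega>)) borel (\<lambda>\<omega>. I k \<omega> $ i)" by simp
  show "integrable M (\<lambda>\<omega>. f (selections \<omega>) * I k \<omega> $ i)"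
    by (rule indep_var_integrable[OF iv int integrable_selection])
  show "expectation (\<lambda>\<omega>. f (selections \<omega>) * I k \<omega> $ i) = \<alpha> * expectation (\<lambda>\<omega>. f (selections \<omega>))"
    using indep_var_lebesgue_integral[OF iv int integrable_selection] by (simp add: mean)
qed

end

section \<open>Orbits as functions of the selections\<close>

text \<open>
  The iterates as functions of a whole, arbitrary sequence of selections, in order to
  obtain measurability from continuity.
\<close>

primrec random_orbit ::
    "real \<Rightarrow> ('a::real_inner ^ 'm::finite \<Rightarrow> 'a ^ 'm) \<Rightarrow> 'a ^ 'm \<Rightarrow> nat \<Rightarrow> (nat \<Rightarrow> real ^ 'm) \<Rightarrow> 'a ^ 'm" where
  "random_orbit \<theta> T x0 0 s = x0"
| "random_orbit \<theta> T x0 (Suc k) s = T_sel \<theta> T (s k) (random_orbit \<theta> T x0 k s)"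

lemma random_orbit_past:
  "(\<And>j. j < k \<Longrightarrow> s j = t j) \<Longrightarrow> random_orbit \<theta> T x0 k s = random_orbit \<theta> T x0 k t"
  by (induction k) auto

lemma random_orbit_in_direct_sum:
  assumes "\<And>i. subspace (V i)" "\<theta> \<noteq> 0" "T \<in> direct_sum V \<rightarrow> direct_sum V" "x0 \<in> direct_sum V"
  shows "random_orbit \<theta> T x0 k s \<in> direct_sum V"
proof (induction k)
  case (Suc k)
  then have "T (random_orbit \<theta> T x0 k s) \<in> direct_sum V" using assms(3) by blast
  with Suc show ?case
    by (simp add: direct_sum_def T_sel_nth assms(1,2) subspace_diff subspace_scale)
qed (simp add: assms)

lemma continuous_random_orbit:
  fixes T :: "'a::real_inner ^ 'm::finite \<Rightarrow> 'a ^ 'm"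
  assumes V: "\<And>i. subspace (V i)" "\<theta> \<noteq> 0" "T \<in> direct_sum V \<rightarrow> direct_sum V" "x0 \<in> direct_sum V"
    and T: "continuous_on (direct_sum V) T"
  shows "continuous_on UNIV (random_orbit \<theta> T x0 k)"
    and "continuous_on UNIV (\<lambda>s. T (random_orbit \<theta> T x0 k s))"
proof -
  have step: "continuous_on UNIV (\<lambda>s. T (random_orbit \<theta> T x0 k s))"
    if "continuous_on UNIV (random_orbit \<theta> T x0 k)" for k
    using random_orbit_in_direct_sum[OF V]
    by (intro continuous_on_compose2[OF T that]) auto
  show main: "continuous_on UNIV (random_orbit \<theta> T x0 k)"
  proof (induction k)
    case (Suc k)
    have eq: "random_orbit \<theta> T x0 (Suc k) = (\<lambda>s. \<chi> i. random_orbit \<theta> T x0 k s $ i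
        - (s k $ i) *\<^sub>R (random_orbit \<theta> T x0 k s - T (random_orbit \<theta> T x0 k s)) $ i)"
      by (auto simp: fun_eq_iff vec_eq_iff T_sel_nth V(2))
    show ?case unfolding eq
      by (intro continuous_intros continuous_on_product_coordinates Suc step[OF Suc])
  qed simp
  show "continuous_on UNIV (\<lambda>s. T (random_orbit \<theta> T x0 k s))" by (rule step[OF main])
qed

section \<open>Random orbits stay close to the relaxed orbit\<close>

text \<open>
  The event \<open>A\<close> depends only on the selections before time \<open>k\<close>, so that this states the bound
  \<open>E[W\<^sub>k\<^sub>+\<^sub>1 | past] \<le> W\<^sub>k + \<parallel>z - T z\<parallel>\<^sup>2 / (1 - \<theta>)\<close> without conditional expectations. The bound of
  \<open>T_sel_squared_dist\<close> has the form \<open>a + \<Sum>i. b i * I k $ i\<close> with \<open>a\<close> and \<open>b i\<close> functions of the past, and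
  independence replaces \<open>I k $ i\<close> by \<open>\<alpha>\<close>.
\<close>

lemma (in random_selections) mean_square_step:
  fixes T :: "'a::real_inner ^ 'm \<Rightarrow> 'a ^ 'm"
  assumes V: "\<And>i. subspace (V i)" and \<theta>: "0 < \<theta>" "\<theta> < 1" and \<alpha>: "0 \<le> \<alpha>" "\<alpha> \<le> 1"
    and T: "T \<in> direct_sum V \<rightarrow> direct_sum V" "averaged_on \<theta> (direct_sum V) T"
    and x0: "x0 \<in> direct_sum V" and z: "z \<in> direct_sum V"
    and A[measurable]: "A \<in> sets borel"
    and past: "\<And>s t. (\<And>j. j < k \<Longrightarrow> s j = t j) \<Longrightarrow> s \<in> A \<longleftrightarrow> t \<in> A"
  shows "expectation (\<lambda>\<omega>. indicator A (selections \<omega>) *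
        (norm (random_orbit \<theta> T x0 (Suc k) (selections \<omega>) - (z - \<alpha> *\<^sub>R (z - T z))))\<^sup>2)
    \<le> expectation (\<lambda>\<omega>. indicator A (selections \<omega>) *
        ((norm (random_orbit \<theta> T x0 k (selections \<omega>) - z))\<^sup>2 + (norm (z - T z))\<^sup>2 / (1 - \<theta>)))"
proof -
  have \<theta>0: "\<theta> \<noteq> 0" using \<theta> by simp
  have "continuous_on (direct_sum V) T"
    using averaged_on_imp_nonexpansive[OF T(2)] \<theta> lipschitz_on_continuous_on by auto
  note cont = continuous_random_orbit[OF V \<theta>0 T(1) x0 this]
  define h where "h = z - T z"
  define x where "x = random_orbit \<theta> T x0 k"
  have x: "x s \<in> direct_sum V" for s
    unfolding x_def by (rule random_orbit_in_direct_sum[OF V \<theta>0 T(1) x0])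
  have contx: "continuous_on UNIV x" "continuous_on UNIV (\<lambda>s. T (x s))"
    unfolding x_def by (rule cont)+
  define a where "a s = (norm (x s - z))\<^sup>2 + 2 * \<alpha> * ((x s - z) \<bullet> h) + \<alpha>\<^sup>2 * (norm h)\<^sup>2" for s
  define b where "b i s = (norm ((x s - T (x s)) $ i))\<^sup>2 - 2 * \<alpha> * ((x s - T (x s)) $ i \<bullet> h $ i)
          - 2 * ((x s - z) $ i \<bullet> (x s - T (x s)) $ i)" for i s
  have conta: "continuous_on UNIV a" and contb: "continuous_on UNIV (b i)" for i
    unfolding a_def b_def by (intro continuous_intros contx)+
  have xpast: "x s = x t" if "\<And>j. j < k \<Longrightarrow> s j = t j" for s t
    unfolding x_def using that by (rule random_orbit_past)
  have [measurable]: "b i \<in> borel_measurable borel" for i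
    using contb by (rule borel_measurable_continuous_onI)
  have int_a: "integrable M (\<lambda>\<omega>. indicator A (selections \<omega>) * a (selections \<omega>))"
    and int_b: "integrable M (\<lambda>\<omega>. indicator A (selections \<omega>) * b i (selections \<omega>))" for i
    by (intro integrable_indicator_selections A conta contb)+
  have past_b: "indicator A s * b i s = indicator A t * b i t" if "\<And>j. j < k \<Longrightarrow> s j = t j" for i s t
    using past[OF that] xpast[OF that] by (simp add: b_def indicator_def)
  note fresh = expectation_mult_selection[where k=k, OF _ past_b int_b]
  have "expectation (\<lambda>\<omega>. indicator A (selections \<omega>) *
        (norm (random_orbit \<theta> T x0 (Suc k) (selections \<omega>) - (z - \<alpha> *\<^sub>R h)))\<^sup>2)
    \<le> expectation (\<lambda>\<omega>. indicator A (selections \<omega>) * a (selections \<omega>)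
        + (\<Sum>i\<in>UNIV. indicator A (selections \<omega>) * b i (selections \<omega>) * I k \<omega> $ i))"
  proof (rule integral_mono)
    show "integrable M (\<lambda>\<omega>. indicator A (selections \<omega>) *
        (norm (random_orbit \<theta> T x0 (Suc k) (selections \<omega>) - (z - \<alpha> *\<^sub>R h)))\<^sup>2)"
      by (intro integrable_indicator_selections A continuous_intros cont)
    show "integrable M (\<lambda>\<omega>. indicator A (selections \<omega>) * a (selections \<omega>)
        + (\<Sum>i\<in>UNIV. indicator A (selections \<omega>) * b i (selections \<omega>) * I k \<omega> $ i))"
      by (intro Bochner_Integration.integrable_add Bochner_Integration.integrable_sum int_a fresh) measurable
    fix \<omega> assume "\<omega> \<in> space M"
    then have "(norm (random_orbit \<theta> T x0 (Suc k) (selections \<omega>) - (z - \<alpha> *\<^sub>R h)))\<^sup>2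
        \<le> a (selections \<omega>) + (\<Sum>i\<in>UNIV. b i (selections \<omega>) * I k \<omega> $ i)"
      using T_sel_squared_dist[OF \<theta>0, where s="I k \<omega>"] selection
      by (simp add: a_def b_def x_def selections_def)
    then show "indicator A (selections \<omega>) * (norm (random_orbit \<theta> T x0 (Suc k) (selections \<omega>) - (z - \<alpha> *\<^sub>R h)))\<^sup>2
        \<le> indicator A (selections \<omega>) * a (selections \<omega>) + (\<Sum>i\<in>UNIV. indicator A (selections \<omega>) * b i (selections \<omega>) * I k \<omega> $ i)"
      by (simp add: indicator_def)
  qed
  also have "\<dots> = expectation (\<lambda>\<omega>. indicator A (selections \<omega>) * a (selections \<omega>))
      + (\<Sum>i\<in>UNIV. \<alpha> * expectation (\<lambda>\<omega>. indicator A (selections \<omega>) * b i (selections \<omega>)))"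
  proof -
    have "integrable M (\<lambda>\<omega>. indicator A (selections \<omega>) * b i (selections \<omega>) * I k \<omega> $ i)"
      "expectation (\<lambda>\<omega>. indicator A (selections \<omega>) * b i (selections \<omega>) * I k \<omega> $ i)
        = \<alpha> * expectation (\<lambda>\<omega>. indicator A (selections \<omega>) * b i (selections \<omega>))" for i
      by (rule fresh; measurable)+
    then show ?thesis using int_a by simp
  qed
  also have "\<dots> = expectation (\<lambda>\<omega>. indicator A (selections \<omega>) * a (selections \<omega>)
      + (\<Sum>i\<in>UNIV. \<alpha> * (indicator A (selections \<omega>) * b i (selections \<omega>))))"
    using int_a int_b by simp
  also have "\<dots> \<le> expectation (\<lambda>\<omega>. indicator A (selections \<omega>) *
        ((norm (x (selections \<omega>) - z))\<^sup>2 + (norm h)\<^sup>2 / (1 - \<theta>)))"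
  proof (rule integral_mono)
    show "integrable M (\<lambda>\<omega>. indicator A (selections \<omega>) * a (selections \<omega>)
      + (\<Sum>i\<in>UNIV. \<alpha> * (indicator A (selections \<omega>) * b i (selections \<omega>))))"
      using int_a int_b by simp
    show "integrable M (\<lambda>\<omega>. indicator A (selections \<omega>) *
        ((norm (x (selections \<omega>) - z))\<^sup>2 + (norm h)\<^sup>2 / (1 - \<theta>)))"
      using \<theta> by (intro integrable_indicator_selections A continuous_intros contx) auto
    fix \<omega>
    let ?x = "x (selections \<omega>)"
    have "(\<Sum>i\<in>UNIV. b i (selections \<omega>))
        = (norm (?x - T ?x))\<^sup>2 - 2 * \<alpha> * ((?x - T ?x) \<bullet> h) - 2 * ((?x - z) \<bullet> (?x - T ?x))"
      unfolding b_def power2_norm_eq_inner inner_vec_def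
      by (simp add: sum_subtractf sum_distrib_left)
    then have "a (selections \<omega>) + \<alpha> * (\<Sum>i\<in>UNIV. b i (selections \<omega>))
        \<le> (norm (?x - z))\<^sup>2 + (norm h)\<^sup>2 / (1 - \<theta>)"
      using cocoercive_mean_step[OF averaged_on_displacement_cocoercive[OF T(2) x z] \<theta> \<alpha>]
      by (simp add: a_def h_def)
    then show "indicator A (selections \<omega>) * a (selections \<omega>)
      + (\<Sum>i\<in>UNIV. \<alpha> * (indicator A (selections \<omega>) * b i (selections \<omega>)))
      \<le> indicator A (selections \<omega>) * ((norm (?x - z))\<^sup>2 + (norm h)\<^sup>2 / (1 - \<theta>))"
      by (simp add: indicator_def sum_distrib_left)
  qed
  finally show ?thesis unfolding h_def x_def .
qed

text \<open>
  Along the relaxed orbit \<open>z\<close> the displacement is never longer than at \<open>x0\<close>, so the noise added in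
  each step of \<open>mean_square_step\<close> is at most \<open>K\<close>. The squared distance then grows linearly in mean,
  and \<open>supermartingale_AE_tendsto_0\<close> upgrades this to almost sure convergence after division
  by \<open>(k + 1)\<^sup>2\<close>.
\<close>

lemma (in random_selections) random_orbit_tracks_relaxed_orbit:
  fixes T :: "'a::real_inner ^ 'm \<Rightarrow> 'a ^ 'm"
  assumes V: "\<And>i. subspace (V i)" and \<theta>: "0 < \<theta>" "\<theta> < 1" and \<alpha>: "0 < \<alpha>" "\<alpha> \<le> 1"
    and T: "T \<in> direct_sum V \<rightarrow> direct_sum V" "averaged_on \<theta> (direct_sum V) T"
    and x0: "x0 \<in> direct_sum V"
  defines "U \<equiv> \<lambda>x. (1 - \<alpha>) *\<^sub>R x + \<alpha> *\<^sub>R T x"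
  shows "AE \<omega> in M. (\<lambda>k. (random_orbit \<theta> T x0 k (selections \<omega>) - (U ^^ k) x0) /\<^sub>R real k) \<longlonglongrightarrow> 0"
proof -
  have T1: "1-lipschitz_on (direct_sum V) T"
    using averaged_on_imp_nonexpansive[OF T(2)] \<theta> by simp
  have UH: "U \<in> direct_sum V \<rightarrow> direct_sum V"
    unfolding U_def using subspace_direct_sum[OF V] T(1)
    by (auto intro!: subspace_add subspace_scale)
  have U1: "1-lipschitz_on (direct_sum V) U"
    unfolding U_def using T1 \<alpha> by (intro lipschitz_on_relaxation) auto
  have \<theta>0: "\<theta> \<noteq> 0" using \<theta> by simp
  note cont = continuous_random_orbit(1)[OF V \<theta>0 T(1) x0 lipschitz_on_continuous_on[OF T1]]
  define z where "z k = (U ^^ k) x0" for k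
  have z: "z k \<in> direct_sum V" for k
    unfolding z_def by (rule funpow_in[OF UH x0])
  have zSuc: "z (Suc k) = z k - \<alpha> *\<^sub>R (z k - T (z k))" for k
    by (simp add: z_def U_def algebra_simps)
  define K where "K = (norm (x0 - T x0))\<^sup>2 / (1 - \<theta>)"
  have K: "K \<ge> 0" using \<theta> by (simp add: K_def)
  define W where "W k s = (norm (random_orbit \<theta> T x0 k s - z k))\<^sup>2" for k s
  have contW: "continuous_on UNIV (W k)" for k
    unfolding W_def by (intro continuous_intros cont)
  have displacement: "(norm (z k - T (z k)))\<^sup>2 / (1 - \<theta>) \<le> K" for k
  proof -
    have "norm (z k - U (z k)) \<le> norm (x0 - U x0)"
      unfolding z_def by (rule nonexpansive_displacement_decreasing[OF UH U1 x0])
    moreover have "x - U x = \<alpha> *\<^sub>R (x - T x)" for x by (simp add: U_def algebra_simps)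
    ultimately have "norm (z k - T (z k)) \<le> norm (x0 - T x0)" using \<alpha>(1) by simp
    then show ?thesis unfolding K_def using \<theta> by (intro divide_right_mono power_mono) auto
  qed

  have step: "expectation (\<lambda>\<omega>. indicator A (selections \<omega>) * W (Suc k) (selections \<omega>))
      \<le> expectation (\<lambda>\<omega>. indicator A (selections \<omega>) * (W k (selections \<omega>) + K))"
    if A: "A \<in> sets borel" and past: "\<And>s t. (\<And>j. j < k \<Longrightarrow> s j = t j) \<Longrightarrow> s \<in> A \<longleftrightarrow> t \<in> A" for A k
  proof -
    have "expectation (\<lambda>\<omega>. indicator A (selections \<omega>) * W (Suc k) (selections \<omega>))
      \<le> expectation (\<lambda>\<omega>. indicator A (selections \<omega>) * (W k (selections \<omega>) + (norm (z k - T (z k)))\<^sup>2 / (1 - \<theta>)))"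
      using mean_square_step[OF V \<theta> less_imp_le[OF \<alpha>(1)] \<alpha>(2) T x0 z A past] unfolding W_def zSuc .
    also have "\<dots> \<le> expectation (\<lambda>\<omega>. indicator A (selections \<omega>) * (W k (selections \<omega>) + K))"
      using displacement[of k] \<theta>
      by (intro integral_mono integrable_indicator_selections A continuous_intros contW)
        (auto simp: indicator_def)
    finally show ?thesis .
  qed
  \<comment> \<open>The summand \<open>K (k + 1)\<close> pays for the noise: the step from \<open>k\<close> to \<open>k + 1\<close> uses
    \<open>(k + 3) / (k + 2)\<^sup>2 \<le> 1 / (k + 1)\<close>.\<close>
  define Y where "Y k s = (W k s + K * (real k + 1)) / (real k + 1)\<^sup>2" for k s
  have contY: "continuous_on UNIV (Y k)" for k
    unfolding Y_def by (intro continuous_intros contW) auto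
  have Ymeas: "Y k \<in> borel_measurable borel" for k
    using contY by (rule borel_measurable_continuous_onI)
  have Ypast: "Y k s = Y k t" if "\<And>j. j < k \<Longrightarrow> s j = t j" for k s t
    unfolding Y_def W_def using that by (subst random_orbit_past[of k s t]) auto
  have growth: "expectation (\<lambda>\<omega>. W k (selections \<omega>)) \<le> K * real k" for k
  proof (induction k)
    case 0 then show ?case by (simp add: W_def z_def)
  next
    case (Suc k)
    have "expectation (\<lambda>\<omega>. W (Suc k) (selections \<omega>)) \<le> expectation (\<lambda>\<omega>. W k (selections \<omega>) + K)"
      using step[of UNIV k] by simp
    also have "\<dots> = expectation (\<lambda>\<omega>. W k (selections \<omega>)) + K"
      using integrable_continuous_selections[OF contW] by (simp add: prob_space)
    finally show ?case using Suc by (simp add: algebra_simps)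
  qed
  have "AE \<omega> in M. (\<lambda>k. Y k (selections \<omega>)) \<longlonglongrightarrow> 0"
  proof (rule supermartingale_AE_tendsto_0)
    show "integrable M (\<lambda>\<omega>. Y k (selections \<omega>))" for k
      by (rule integrable_continuous_selections[OF contY])
    show "0 \<le> Y k (selections \<omega>)" for k \<omega>
      using K by (simp add: Y_def W_def)
    show "(\<integral>\<omega>. indicator {\<omega> \<in> space M. \<forall>i\<in>{n..k}. Y i (selections \<omega>) < c} \<omega> * Y (Suc k) (selections \<omega>) \<partial>M)
      \<le> (\<integral>\<omega>. indicator {\<omega> \<in> space M. \<forall>i\<in>{n..k}. Y i (selections \<omega>) < c} \<omega> * Y k (selections \<omega>) \<partial>M)" for n k c
    proof -
      define A where "A = {s. \<forall>i\<in>{n..k}. Y i s < c}"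
      note [measurable] = Ymeas
      have A: "A \<in> sets borel" unfolding A_def by measurable
      have past: "s \<in> A \<longleftrightarrow> t \<in> A" if "\<And>j. j < k \<Longrightarrow> s j = t j" for s t
        using Ypast[of _ s t] that by (auto simp: A_def)
      have ind: "indicator {\<omega> \<in> space M. \<forall>i\<in>{n..k}. Y i (selections \<omega>) < c} \<omega> = (indicator A (selections \<omega>) :: real)"
        if "\<omega> \<in> space M" for \<omega>
        using that by (simp add: A_def indicator_def)
      have lin: "expectation (\<lambda>\<omega>. indicator A (selections \<omega>) * ((f (selections \<omega>) + g (selections \<omega>)) / r))
          = (expectation (\<lambda>\<omega>. indicator A (selections \<omega>) * f (selections \<omega>))
            + expectation (\<lambda>\<omega>. indicator A (selections \<omega>) * g (selections \<omega>))) / r"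
        if "continuous_on UNIV f" "continuous_on UNIV g" for f g :: "(nat \<Rightarrow> real ^ 'm) \<Rightarrow> real" and r
        using integrable_indicator_selections[OF A that(1)] integrable_indicator_selections[OF A that(2)]
        by (simp add: distrib_left)
      let ?q = "real k + 2"
      have "expectation (\<lambda>\<omega>. indicator A (selections \<omega>) * Y (Suc k) (selections \<omega>))
          = (expectation (\<lambda>\<omega>. indicator A (selections \<omega>) * W (Suc k) (selections \<omega>))
            + expectation (\<lambda>\<omega>. indicator A (selections \<omega>) * (K * ?q))) / ?q\<^sup>2"
        using lin[OF contW[of "Suc k"] continuous_on_const[of UNIV "K * ?q"], of "?q\<^sup>2"]
        by (simp add: Y_def add_ac)
      also have "\<dots> \<le> (expectation (\<lambda>\<omega>. indicator A (selections \<omega>) * (W k (selections \<omega>) + K))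
            + expectation (\<lambda>\<omega>. indicator A (selections \<omega>) * (K * ?q))) / ?q\<^sup>2"
        using step[OF A past] by (intro divide_right_mono add_right_mono) auto
      also have "\<dots> = expectation (\<lambda>\<omega>. indicator A (selections \<omega>) * ((W k (selections \<omega>) + K + K * ?q) / ?q\<^sup>2))"
        using contW[of k] by (intro lin[symmetric] continuous_intros) auto
      also have "\<dots> \<le> expectation (\<lambda>\<omega>. indicator A (selections \<omega>) * Y k (selections \<omega>))"
      proof (intro integral_mono integrable_indicator_selections A contY)
        show "continuous_on UNIV (\<lambda>s. (W k s + K + K * ?q) / ?q\<^sup>2)"
          by (intro continuous_intros contW) auto
        fix \<omega>
        have "(W k (selections \<omega>) + K + K * ?q) / ?q\<^sup>2 = W k (selections \<omega>) / ?q\<^sup>2 + K * ((?q + 1) / ?q\<^sup>2)"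
          by (simp add: field_simps)
        also have "\<dots> \<le> W k (selections \<omega>) / (real k + 1)\<^sup>2 + K * (1 / (real k + 1))"
        proof (intro add_mono mult_left_mono K divide_left_mono)
          show "(?q + 1) / ?q\<^sup>2 \<le> 1 / (real k + 1)"
            by (simp add: divide_simps power2_eq_square algebra_simps not_less add_nonneg_nonneg)
        qed (auto simp: W_def)
        also have "\<dots> = Y k (selections \<omega>)"
          by (simp add: Y_def add_divide_distrib power2_eq_square)
        finally show "indicator A (selections \<omega>) * ((W k (selections \<omega>) + K + K * ?q) / ?q\<^sup>2)
            \<le> indicator A (selections \<omega>) * Y k (selections \<omega>)"
          by (simp add: indicator_def)
      qed
      finally show ?thesis
        by (simp add: ind cong: Bochner_Integration.integral_cong)
    qed
    show "(\<lambda>k. expectation (\<lambda>\<omega>. Y k (selections \<omega>))) \<longlonglongrightarrow> 0"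
    proof (rule tendsto_sandwich[where f="\<lambda>_. 0"])
      have "expectation (\<lambda>\<omega>. Y k (selections \<omega>)) \<le> 2 * K / (real k + 1)" for k
      proof -
        have "expectation (\<lambda>\<omega>. Y k (selections \<omega>)) = (expectation (\<lambda>\<omega>. W k (selections \<omega>)) + K * (real k + 1)) / (real k + 1)\<^sup>2"
          using integrable_continuous_selections[OF contW] by (simp add: Y_def prob_space)
        also have "\<dots> \<le> (2 * K * (real k + 1)) / (real k + 1)\<^sup>2"
          using growth[of k] K by (intro divide_right_mono) (auto simp: algebra_simps)
        also have "\<dots> = 2 * K / (real k + 1)" by (simp add: power2_eq_square)
        finally show ?thesis .
      qed
      then show "eventually (\<lambda>k. expectation (\<lambda>\<omega>. Y k (selections \<omega>)) \<le> 2 * K / (real k + 1)) sequentially"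
        by simp
      show "(\<lambda>k. 2 * K / (real k + 1)) \<longlonglongrightarrow> 0"
        using LIMSEQ_Suc[OF lim_const_over_n[of "2 * K"]] by (simp add: add.commute)
      show "eventually (\<lambda>k. 0 \<le> expectation (\<lambda>\<omega>. Y k (selections \<omega>))) sequentially"
        using K by (intro always_eventually allI integral_nonneg_AE AE_I2) (simp add: Y_def W_def)
    qed simp
  qed
  then show ?thesis
  proof (rule AE_mp, intro AE_I2 impI)
    fix \<omega> assume Y0: "(\<lambda>k. Y k (selections \<omega>)) \<longlonglongrightarrow> 0"
    let ?d = "\<lambda>k. norm (random_orbit \<theta> T x0 k (selections \<omega>) - (U ^^ k) x0)"
    have lim: "(\<lambda>k. 2 * sqrt (Y k (selections \<omega>))) \<longlonglongrightarrow> 0"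
      using tendsto_mult[OF tendsto_const[of 2] tendsto_real_sqrt[OF Y0]] by simp
    show "(\<lambda>k. (random_orbit \<theta> T x0 k (selections \<omega>) - (U ^^ k) x0) /\<^sub>R real k) \<longlonglongrightarrow> 0"
    proof (rule Lim_null_comparison[OF _ lim])
      show "eventually (\<lambda>k. norm ((random_orbit \<theta> T x0 k (selections \<omega>) - (U ^^ k) x0) /\<^sub>R real k)
          \<le> 2 * sqrt (Y k (selections \<omega>))) sequentially"
        using eventually_gt_at_top[of 0]
      proof eventually_elim
        case (elim k)
        have "(?d k)\<^sup>2 / (real k + 1)\<^sup>2 \<le> Y k (selections \<omega>)"
          unfolding Y_def W_def z_def using K by (intro divide_right_mono) auto
        then have "(?d k / (real k + 1))\<^sup>2 \<le> Y k (selections \<omega>)" by (simp add: power_divide)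
        then have "?d k / (real k + 1) \<le> sqrt (Y k (selections \<omega>))" by (rule real_le_rsqrt)
        moreover have "?d k / (2 * real k) \<le> ?d k / (real k + 1)"
          using elim by (intro divide_left_mono) auto
        moreover have "?d k / real k = 2 * (?d k / (2 * real k))" by simp
        ultimately have "?d k / real k \<le> 2 * sqrt (Y k (selections \<omega>))" by linarith
        then show ?case by (simp add: divide_inverse mult.commute)
      qed
    qed
  qed
qed

section \<open>The limit of the normalized random iterates\<close>

theorem theorem4p7:
  fixes V :: "'m::finite \<Rightarrow> 'a::real_inner set"
    and T :: "'a ^ 'm \<Rightarrow> 'a ^ 'm"
    and \<theta> \<alpha> :: real
    and M :: "'w measure"
    and D :: "(real ^ 'm) measure"
    and I :: "nat \<Rightarrow> 'w \<Rightarrow> real ^ 'm"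
    and x0 :: "'a ^ 'm"
    and x :: "nat \<Rightarrow> 'w \<Rightarrow> 'a ^ 'm"
  assumes "\<And>i. hilbert_subspace (V i)"
    and "0 < \<theta>" and "\<theta> < 1"
    and "T \<in> direct_sum V \<rightarrow> direct_sum V"
    and "averaged_on \<theta> (direct_sum V) T"
    and "prob_space M"
    and "prob_space.indep_vars M (\<lambda>_. borel) I UNIV"
    and "\<And>k. distr M borel (I k) = D"
    and "\<And>k \<omega> i. \<omega> \<in> space M \<Longrightarrow> I k \<omega> $ i \<in> {0..1}"
    and "0 < \<alpha>" and "\<alpha> \<le> 1"
    and "(\<integral>s. s \<partial>D) = \<alpha> *\<^sub>R 1"
    and "x0 \<in> direct_sum V"
    and "\<And>\<omega>. \<omega> \<in> space M \<Longrightarrow> x 0 \<omega> = x0"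
    and "\<And>k \<omega>. \<omega> \<in> space M \<Longrightarrow> x (Suc k) \<omega> = T_sel \<theta> T (I k \<omega>) (x k \<omega>)"
  shows "AE \<omega> in M. (\<lambda>k. x k \<omega> /\<^sub>R real k) \<longlonglongrightarrow> - (\<alpha> *\<^sub>R infimal_displacement (direct_sum V) T)"
proof -
  interpret prob_space M by fact
  have V: "\<And>i. subspace (V i)" "\<And>i. Topological_Spaces.complete (V i)"
    using assms(1) by (auto simp: hilbert_subspace_def)
  have I [measurable]: "I k \<in> borel_measurable M" for k
    using assms(7) unfolding indep_vars_def by auto
  have mean: "expectation (\<lambda>\<omega>. I k \<omega> $ i) = \<alpha>" for k i
  proof -
    have "AE \<omega> in M. norm (I k \<omega>) \<le> real CARD('m)"
    proof (rule AE_I2)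
      fix \<omega> assume "\<omega> \<in> space M"
      then have "(\<Sum>i\<in>UNIV. \<bar>I k \<omega> $ i\<bar>) \<le> (\<Sum>i\<in>(UNIV :: 'm set). 1)"
        using assms(9) by (intro sum_mono) auto
      then show "norm (I k \<omega>) \<le> real CARD('m)"
        using norm_le_l1_cart[of "I k \<omega>"] by simp
    qed
    then have int: "integrable M (I k)"
      by (intro integrable_const_bound[where B="real CARD('m)"]) measurable
    have "expectation (\<lambda>\<omega>. I k \<omega> $ i) = expectation (I k) $ i"
      using bounded_linear_vec_nth int by (rule integral_bounded_linear)
    also have "expectation (I k) = (\<integral>s. s \<partial>distr M borel (I k))"
      by (subst integral_distr) auto
    also have "\<dots> = \<alpha> *\<^sub>R 1" by (simp only: assms(8,12))
    finally show ?thesis by simp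
  qed
  interpret random_selections M I \<alpha>
    using assms(7,9) mean by unfold_locales auto

  define H where "H = direct_sum V"
  have H: "subspace H" "Topological_Spaces.complete H"
    unfolding H_def using V by (simp_all add: subspace_direct_sum complete_direct_sum)
  have TH: "T \<in> H \<rightarrow> H" and x0: "x0 \<in> H" using assms(4,13) by (simp_all add: H_def)
  have T1: "1-lipschitz_on H T"
    using averaged_on_imp_nonexpansive[OF assms(5)] assms(2,3) by (simp add: H_def)
  obtain v where v: "v \<in> closure ((\<lambda>x. x - T x) ` H)"
    and var: "\<And>u. u \<in> H \<Longrightarrow> (norm v)\<^sup>2 \<le> (u - T u) \<bullet> v"
    using ex_variational_displacement[OF H TH T1] by blast
  have infimal: "infimal_displacement H T = v"
    using v var by (rule infimal_displacement_eqI)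

  define U where "U = (\<lambda>x. (1 - \<alpha>) *\<^sub>R x + \<alpha> *\<^sub>R T x)"
  have disp: "u - U u = \<alpha> *\<^sub>R (u - T u)" for u by (simp add: U_def algebra_simps)
  have deterministic: "(\<lambda>n. (U ^^ n) x0 /\<^sub>R real n) \<longlonglongrightarrow> - (\<alpha> *\<^sub>R v)"
  proof (rule nonexpansive_average_displacement[OF _ _ x0])
    show "U \<in> H \<rightarrow> H"
      unfolding U_def using H(1) TH by (auto intro!: subspace_add subspace_scale)
    show "1-lipschitz_on H U"
      unfolding U_def using T1 assms(10,11) by (intro lipschitz_on_relaxation) auto
    have "(\<lambda>x. x - U x) ` H = (*\<^sub>R) \<alpha> ` ((\<lambda>x. x - T x) ` H)"
      by (simp add: disp image_image)
    then show "\<alpha> *\<^sub>R v \<in> closure ((\<lambda>x. x - U x) ` H)"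
      using imageI[OF v, of "(*\<^sub>R) \<alpha>"] by (simp only: closure_scaleR)
    fix u assume "u \<in> H"
    then have "\<alpha>\<^sup>2 * (norm v)\<^sup>2 \<le> \<alpha>\<^sup>2 * ((u - T u) \<bullet> v)"
      by (intro mult_left_mono var) auto
    then show "(norm (\<alpha> *\<^sub>R v))\<^sup>2 \<le> (u - U u) \<bullet> (\<alpha> *\<^sub>R v)"
      using assms(10) unfolding disp by (simp add: power_mult_distrib power2_eq_square mult.assoc)
  qed

  have orbit: "x k \<omega> = random_orbit \<theta> T x0 k (selections \<omega>)" if "\<omega> \<in> space M" for k \<omega>
    using that by (induction k) (simp_all add: assms(14,15) selections_def)
  have "AE \<omega> in M. (\<lambda>k. (random_orbit \<theta> T x0 k (selections \<omega>) - (U ^^ k) x0) /\<^sub>R real k) \<longlonglongrightarrow> 0"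
    unfolding U_def
    by (rule random_orbit_tracks_relaxed_orbit[OF V(1) assms(2,3,10,11,4,5,13)])
  then show ?thesis
  proof (rule AE_mp, intro AE_I2 impI)
    fix \<omega> assume \<omega>: "\<omega> \<in> space M"
      and "(\<lambda>k. (random_orbit \<theta> T x0 k (selections \<omega>) - (U ^^ k) x0) /\<^sub>R real k) \<longlonglongrightarrow> 0"
    from tendsto_add[OF this(2) deterministic]
    show "(\<lambda>k. x k \<omega> /\<^sub>R real k) \<longlonglongrightarrow> - (\<alpha> *\<^sub>R infimal_displacement (direct_sum V) T)"
      using infimal by (simp add: orbit[OF \<omega>] H_def flip: scaleR_add_right)
  qed
qed

end
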